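(* There exists a concise free tensor $T \in \mathbb{C}^3 \otimes \mathbb{C}^3 \otimes \mathbb{C}^3$ such that its orbit closure $\overline{\mathrm{GL}\cdot T}$ contains a concise non-free tensor, where $\mathrm{GL}=\mathrm{GL}_3(\mathbb{C})\times\mathrm{GL}_3(\mathbb{C})\times\mathrm{GL}_3(\mathbb{C})$.
   Context: The group $\mathrm{GL}=\mathrm{GL}_3(\mathbb{C})^3$ acts on $\mathbb{C}^3\otimes\mathbb{C}^3\otimes\mathbb{C}^3$ by $(g_1,g_2,g_3)\cdot T=(g_1\otimes g_2\otimes g_3)T$; the closure of an orbit is the same in the Euclidean and the Zariski topology. For $T=\sum T_{i,j,k}\, e_i\otimes e_j\otimes e_k$ in the standard basis, $\operatorname{supp}(T)=\{(i,j,k) \mid T_{i,j,k}\neq 0\}$. A set of triples is free if any two distinct elements of it differ in at least two coordinates. A tensor $T$ is free if $\operatorname{supp}(g\cdot T)$ is free for some $g\in\mathrm{GL}$; otherwise it is non-free. A tensor in $\mathbb{C}^3\otimes\mathbb{C}^3\otimes\mathbb{C}^3$ is concise if each of its three flattenings $(\mathbb{C}^3)^*\to\mathbb{C}^3\otimes\mathbb{C}^3$ has full rank $3$. *)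

theory Defs
  imports "HOL-Analysis.Analysis"
begin

text \<open>
  A tensor \<open>T\<close> in the threefold tensor power of \<open>\<complex>\<^sup>3\<close> is given by its coordinates
  \<open>T $ i $ j $ k\<close> with respect to the standard basis \<open>e\<^sub>i \<otimes> e\<^sub>j \<otimes> e\<^sub>k\<close>. The indices have
  type \<open>3\<close>, which has exactly three elements.
\<close>

type_synonym tensor = "complex^3^3^3"

type_synonym mat_triple = "(complex^3^3) \<times> (complex^3^3) \<times> (complex^3^3)"

definition GL :: "mat_triple set" where
  "GL = {(g1, g2, g3). invertible g1 \<and> invertible g2 \<and> invertible g3}"

definition act :: "mat_triple \<Rightarrow> tensor \<Rightarrow> tensor" where
  "act = (\<lambda>(g1, g2, g3) T. \<chi> i j k. \<Sum>a\<in>UNIV. \<Sum>b\<in>UNIV. \<Sum>c\<in>UNIV.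
     g1 $ i $ a * g2 $ j $ b * g3 $ k $ c * T $ a $ b $ c)"

lemma act_pure_tensor:
  "act (g1, g2, g3) (\<chi> i j k. u $ i * v $ j * w $ k) =
     (\<chi> i j k. (g1 *v u) $ i * (g2 *v v) $ j * (g3 *v w) $ k)"
  by (simp add: act_def matrix_vector_mult_def vec_eq_iff sum_3 algebra_simps)

definition orbit :: "tensor \<Rightarrow> tensor set" where
  "orbit T = {act g T | g. g \<in> GL}"

definition supp :: "tensor \<Rightarrow> (3 \<times> 3 \<times> 3) set" where
  "supp T = {(i, j, k). T $ i $ j $ k \<noteq> 0}"

definition free_set :: "('a \<times> 'b \<times> 'c) set \<Rightarrow> bool" where
  "free_set S \<longleftrightarrow> (\<forall>(i, j, k)\<in>S. \<forall>(i', j', k')\<in>S. (i, j, k) \<noteq> (i', j', k') \<longrightarrow>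
     (i \<noteq> i' \<and> j \<noteq> j') \<or> (i \<noteq> i' \<and> k \<noteq> k') \<or> (j \<noteq> j' \<and> k \<noteq> k'))"

definition free_tensor :: "tensor \<Rightarrow> bool" where
  "free_tensor T \<longleftrightarrow> (\<exists>g\<in>GL. free_set (supp (act g T)))"

text \<open>
  The flattenings, as \<open>9 \<times> 3\<close> matrices: each is the matrix of the linear map from
  the dual of \<open>\<complex>\<^sup>3\<close> to \<open>\<complex>\<^sup>3 \<otimes> \<complex>\<^sup>3\<close> that contracts the indicated factor of \<open>T\<close>, in
  the dual standard basis and the standard basis. The rows are indexed by pairs.
\<close>

definition flattening1 :: "tensor \<Rightarrow> complex^3^(3 \<times> 3)" where
  "flattening1 T = (\<chi> p i. T $ i $ fst p $ snd p)"

definition flattening2 :: "tensor \<Rightarrow> complex^3^(3 \<times> 3)" where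
  "flattening2 T = (\<chi> p j. T $ fst p $ j $ snd p)"

definition flattening3 :: "tensor \<Rightarrow> complex^3^(3 \<times> 3)" where
  "flattening3 T = (\<chi> p k. T $ fst p $ snd p $ k)"

definition concise :: "tensor \<Rightarrow> bool" where
  "concise T \<longleftrightarrow> rank (flattening1 T) = 3 \<and> rank (flattening2 T) = 3 \<and> rank (flattening3 T) = 3"

end

theory Submission
  imports Defs
begin

text \<open>
  The diagonal \<open>SL\<^sub>3\<close> fixes the alternating tensor \<open>\<Lambda>\<close>, so the tensors \<open>\<Lambda> + f\<close> with \<open>f\<close> symmetric
  degenerate as ternary cubic forms do. The form \<open>x\<^sub>1\<^sup>3 + x\<^sub>2\<^sup>3\<close> gives a free tensor, as its monomials
  do not collide with \<open>\<Lambda>\<close>, and under \<open>SL\<^sub>3\<close> it degenerates to \<open>3 x\<^sub>1\<^sup>2 x\<^sub>2\<close>, the difference quotient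
  of a cube; this form gives a tensor \<open>S\<close> that is not free.

  Contracting any one factor of \<open>S\<close> with \<open>x\<close> gives a \<open>3 \<times> 3\<close> matrix that has rank at least \<open>2\<close> for
  \<open>x \<noteq> 0\<close> and whose determinant is \<open>3 x\<^sub>1\<^sup>2 x\<^sub>2\<close>. Suppose that \<open>P\<close> in the orbit of \<open>S\<close> has free support.
  Its slices are then matrices with at most one nonzero entry in each row and column and with
  pairwise disjoint supports; each slice has at least two entries because of the rank. The
  determinant of the contraction of \<open>P\<close> is \<open>\<alpha>\<^sup>2 \<beta>\<close> with independent linear forms \<open>\<alpha>\<close> and \<open>\<beta>\<close>. A slice
  with three entries would force the coefficients of \<open>y\<^sub>i\<^sup>2 y\<^sub>j\<close> to vanish while that of \<open>y\<^sub>i\<^sup>3\<close> does not,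
  which makes \<open>\<alpha>\<close> and \<open>\<beta>\<close> proportional. So in every direction each slice has exactly two entries, and
  this leaves only the determinants \<open>c y\<^sub>1 y\<^sub>2 y\<^sub>3\<close> and, up to order, \<open>u y\<^sub>1\<^sup>2 y\<^sub>2 + v y\<^sub>2 y\<^sub>3\<^sup>2\<close> with
  \<open>u, v \<noteq> 0\<close>. Neither has a square factor.
\<close>

section \<open>The two tensors: conciseness and freeness\<close>

lemma rank_eq_card_if_ker:
  fixes A :: "'a::field^'n^'m"
  assumes "\<And>x. A *v x = 0 \<Longrightarrow> x = 0"
  shows "rank A = CARD('n)"
proof -
  have "vec.span (rows A) = UNIV"
    using assms matrix_left_invertible_ker[of A] matrix_left_invertible_span_rows_gen[of A] by simp
  then have "vec.dim (vec.span (rows A)) = CARD('n)"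
    by (simp only: vec_dim_card)
  then show ?thesis
    by (simp only: row_rank_def_gen vec.dim_span)
qed

text \<open>This is \<open>\<Lambda> + e\<^sub>1\<^sup>3 + e\<^sub>2\<^sup>3\<close>.\<close>

definition free_example :: tensor where
  "free_example = (\<chi> i j k.
     if (i, j, k) \<in> {(1, 2, 3), (2, 3, 1), (3, 1, 2), (1, 1, 1), (2, 2, 2)} then 1
     else if (i, j, k) \<in> {(1, 3, 2), (2, 1, 3), (3, 2, 1)} then - 1 else 0)"

text \<open>This is \<open>S\<close>: \<open>\<Lambda>\<close> plus the polarization of the form
  \<open>3 x\<^sub>1\<^sup>2 x\<^sub>2\<close>.\<close>

definition nonfree_example :: tensor where
  "nonfree_example = (\<chi> i j k.
     if (i, j, k) \<in> {(1, 2, 3), (2, 3, 1), (3, 1, 2), (1, 1, 2), (1, 2, 1), (2, 1, 1)} then 1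
     else if (i, j, k) \<in> {(1, 3, 2), (2, 1, 3), (3, 2, 1)} then - 1 else 0)"

lemma concise_free_example: "concise free_example"
proof -
  have "rank (flattening1 free_example) = CARD(3)" "rank (flattening2 free_example) = CARD(3)"
    "rank (flattening3 free_example) = CARD(3)"
    by (rule rank_eq_card_if_ker; force simp: vec_eq_iff matrix_vector_mult_def split_paired_All
        flattening1_def flattening2_def flattening3_def free_example_def forall_3 sum_3)+
  then show ?thesis
    by (simp add: concise_def)
qed

lemma concise_nonfree_example: "concise nonfree_example"
proof -
  have "rank (flattening1 nonfree_example) = CARD(3)" "rank (flattening2 nonfree_example) = CARD(3)"
    "rank (flattening3 nonfree_example) = CARD(3)"
    by (rule rank_eq_card_if_ker; force simp: vec_eq_iff matrix_vector_mult_def split_paired_All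
        flattening1_def flattening2_def flattening3_def nonfree_example_def forall_3 sum_3)+
  then show ?thesis
    by (simp add: concise_def)
qed

lemma act_mat_1: "act (mat 1, mat 1, mat 1) T = T"
  by (simp add: act_def vec_eq_iff forall_3 sum_3 mat_def)

lemma free_tensor_free_example: "free_tensor free_example"
proof -
  have "supp free_example = {(1, 2, 3), (2, 3, 1), (3, 1, 2), (1, 1, 1), (2, 2, 2),
      (1, 3, 2), (2, 1, 3), (3, 2, 1)}"
    by (auto simp: supp_def free_example_def split: if_splits)
  then have "free_set (supp free_example)"
    by (simp add: free_set_def)
  moreover have "(mat 1, mat 1, mat 1) \<in> GL"
    by (simp add: GL_def invertible_det_nz)
  ultimately show ?thesis
    unfolding free_tensor_def by (metis act_mat_1)
qed

section \<open>Degeneration of the free tensor\<close>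

text \<open>
  The matrix has determinant \<open>1\<close> and maps \<open>e\<^sub>1 \<mapsto> t\<^sup>-\<^sup>1 (e\<^sub>1 + t\<^sup>3 e\<^sub>2)\<close> and \<open>e\<^sub>2 \<mapsto> - t\<^sup>-\<^sup>1 e\<^sub>1\<close>, so it sends
  \<open>e\<^sub>1\<^sup>3 + e\<^sub>2\<^sup>3\<close> to the difference quotient \<open>((e\<^sub>1 + s e\<^sub>2)\<^sup>3 - e\<^sub>1\<^sup>3) / s\<close> with \<open>s = t\<^sup>3\<close>.
\<close>

definition degen :: "complex \<Rightarrow> complex^3^3" where
  "degen t = vector [vector [1 / t, - 1 / t, 0], vector [t\<^sup>2, 0, 0], vector [0, 0, 1 / t]]"

lemma degen_in_GL: "t \<noteq> 0 \<Longrightarrow> (degen t, degen t, degen t) \<in> GL"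
  by (simp add: GL_def invertible_det_nz det_3 degen_def)

text \<open>Determinant 1 keeps \<open>\<Lambda>\<close>. With \<open>s = t ^ 3\<close>, the
  correction consists of the terms of order \<open>s\<close> and \<open>s\<^sup>2\<close> in the
  difference quotient of the cube.\<close>

lemma act_degen_free_example:
  assumes "t \<noteq> 0"
  shows "act (degen t, degen t, degen t) free_example =
    nonfree_example + (\<chi> i j k. if (i, j, k) \<in> {(1, 2, 2), (2, 1, 2), (2, 2, 1)} then t ^ 3
      else if (i, j, k) = (2, 2, 2) then t ^ 6 else 0)"
  using assms
  by (simp add: act_def vec_eq_iff forall_3 sum_3 free_example_def nonfree_example_def degen_def
      power_numeral_reduce)

lemma nonfree_example_in_closure: "nonfree_example \<in> closure (orbit free_example)"
  unfolding closure_sequential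
proof (intro exI conjI allI)
  define t :: "nat \<Rightarrow> complex" where "t n = inverse (of_nat (Suc n))" for n
  have t0: "t n \<noteq> 0" for n
    by (simp add: t_def del: of_nat_Suc)
  have "t \<longlonglongrightarrow> 0"
    unfolding t_def by (rule LIMSEQ_Suc[OF lim_inverse_n])
  then have lim: "(\<lambda>n. t n ^ m) \<longlonglongrightarrow> 0" if "m > 0" for m
    using tendsto_power[of t 0 sequentially m] that by (simp add: zero_power)
  let ?X = "\<lambda>n. act (degen (t n), degen (t n), degen (t n)) free_example"
  show "?X n \<in> orbit free_example" for n
    unfolding orbit_def using degen_in_GL[OF t0] by blast
  have "(\<lambda>n. \<chi> i j k. if (i, j, k) \<in> {(1, 2, 2), (2, 1, 2), (2, 2, 1)} then t n ^ 3
      else if (i, j, k) = (2, 2, 2) then t n ^ 6 else 0) \<longlonglongrightarrow> (0 :: tensor)"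
  proof (intro vec_tendstoI)
    fix i j k :: 3
    show "(\<lambda>n. (\<chi> i j k. if (i, j, k) \<in> {(1, 2, 2), (2, 1, 2), (2, 2, 1)} then t n ^ 3
        else if (i, j, k) = (2, 2, 2) then t n ^ 6 else 0) $ i $ j $ k) \<longlonglongrightarrow> (0 :: tensor) $ i $ j $ k"
      by (cases "(i, j, k) \<in> {(1, 2, 2), (2, 1, 2), (2, 2, 1)}"; cases "(i, j, k) = (2, 2, 2)")
        (simp_all only: vec_lambda_beta zero_index if_True if_False refl lim zero_less_numeral tendsto_const)
  qed
  from tendsto_add[OF tendsto_const[of nonfree_example] this]
  show "?X \<longlonglongrightarrow> nonfree_example"
    by (simp only: act_degen_free_example[OF t0] add_0_right)
qed

section \<open>Contractions along the orbit of the non-free tensor\<close>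

definition contract :: "tensor \<Rightarrow> complex^3 \<Rightarrow> complex^3^3" where
  "contract T y = (\<chi> j k. \<Sum>i\<in>UNIV. y $ i * T $ i $ j $ k)"

lemma contract_act:
  "contract (act (g1, g2, g3) T) y = g2 ** contract T (transpose g1 *v y) ** transpose g3"
  by (simp add: contract_def act_def vec_eq_iff matrix_matrix_mult_def matrix_vector_mult_def
      transpose_def sum_3 algebra_simps)

text \<open>The cross-product matrix of \<open>x\<close> plus a symmetric matrix \<open>N\<close>
  has determinant \<open>det N + x\<^sup>T N x\<close>. Here \<open>det N = 0\<close>, and the
  quadratic term is the cubic form at \<open>x\<close>.\<close>

lemma det_contract_nonfree_example: "det (contract nonfree_example x) = 3 * (x $ 1)\<^sup>2 * x $ 2"
  by (simp add: contract_def det_3 sum_3 nonfree_example_def power2_eq_square algebra_simps)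

text \<open>The action on the first factor substitutes \<open>transpose g1 *v y\<close>, so the two
  forms come from the first two columns of \<open>g1\<close>, which are independent. The other
  factors contribute only their determinants, absorbed into \<open>b\<close>.\<close>

lemma det_contract_orbit:
  assumes "P \<in> orbit nonfree_example"
  shows "\<exists>a b :: complex^3.
    (\<forall>y. det (contract P y) = (\<Sum>i\<in>UNIV. a $ i * y $ i)\<^sup>2 * (\<Sum>i\<in>UNIV. b $ i * y $ i)) \<and>
    (\<forall>s t. s *s a + t *s b = 0 \<longrightarrow> s = 0 \<and> t = 0)"
proof -
  obtain g1 g2 g3 where P: "P = act (g1, g2, g3) nonfree_example"
    and inv: "invertible g1" "invertible g2" "invertible g3"
    using assms by (auto simp: orbit_def GL_def)
  define c where "c = 3 * det g2 * det g3"
  have c: "c \<noteq> 0"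
    using inv by (simp add: c_def invertible_det_nz)
  define a where "a = (\<chi> i. g1 $ i $ 1)"
  define b where "b = (\<chi> i. c * g1 $ i $ 2)"
  have [simp]: "det (\<chi> i j. g3 $ j $ i) = det g3"
    using det_transpose[of g3] by (simp add: transpose_def)
  have "det (contract P y) = (\<Sum>i\<in>UNIV. a $ i * y $ i)\<^sup>2 * (\<Sum>i\<in>UNIV. b $ i * y $ i)" for y
    by (simp add: P contract_act det_mul det_contract_nonfree_example a_def b_def c_def
        matrix_vector_mult_def transpose_def sum_3 algebra_simps)
  moreover have "s = 0 \<and> t = 0" if "s *s a + t *s b = 0" for s t
  proof -
    define v :: "complex^3" where "v = vector [s, c * t, 0]"
    have "g1 *v v = s *s a + t *s b"
      by (simp add: v_def a_def b_def vec_eq_iff matrix_vector_mult_def sum_3 algebra_simps)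
    with that inv(1) have "v = 0"
      by (metis invertible_def matrix_left_invertible_ker)
    then show ?thesis
      using c by (simp add: v_def vec_eq_iff forall_3)
  qed
  ultimately show ?thesis
    by blast
qed

section \<open>Symmetries of the orbit and its points with free support\<close>

definition relabel :: "(3 \<Rightarrow> 3) \<Rightarrow> (3 \<Rightarrow> 3) \<Rightarrow> (3 \<Rightarrow> 3) \<Rightarrow> tensor \<Rightarrow> tensor" where
  "relabel p q r T = (\<chi> i j k. T $ p i $ q j $ r k)"

definition rotate_tensor :: "tensor \<Rightarrow> tensor" where
  "rotate_tensor T = (\<chi> i j k. T $ k $ i $ j)"

lemma invertible_permute_rows:
  fixes g :: "complex^3^3" and p :: "3 \<Rightarrow> 3"
  assumes "bij p" "invertible g"
  shows "invertible (\<chi> i. g $ p i)"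
proof -
  have "p permutes UNIV"
    using assms(1) by (simp add: permutes_univ bij_iff)
  from det_permute_rows[OF this, of g] show ?thesis
    using assms(2) by (simp add: invertible_det_nz sign_def)
qed

lemma relabel_orbit:
  assumes "P \<in> orbit T" "bij p" "bij q" "bij r"
  shows "relabel p q r P \<in> orbit T"
proof -
  obtain g1 g2 g3 where P: "P = act (g1, g2, g3) T"
    and inv: "invertible g1" "invertible g2" "invertible g3"
    using assms(1) by (auto simp: orbit_def GL_def)
  have "relabel p q r P = act (\<chi> i. g1 $ p i, \<chi> i. g2 $ q i, \<chi> i. g3 $ r i) T"
    by (simp add: P relabel_def act_def vec_eq_iff)
  then show ?thesis
    using inv assms invertible_permute_rows unfolding orbit_def GL_def by blast
qed

text \<open>Cyclic shifts of the indices fix \<open>nonfree_example\<close>. This carries results on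
  slices in the first direction over to the other two.\<close>

lemma rotate_nonfree_orbit:
  assumes "P \<in> orbit nonfree_example"
  shows "rotate_tensor P \<in> orbit nonfree_example"
proof -
  obtain g1 g2 g3 where P: "P = act (g1, g2, g3) nonfree_example"
    and inv: "invertible g1" "invertible g2" "invertible g3"
    using assms by (auto simp: orbit_def GL_def)
  have "rotate_tensor P = act (g2, g3, g1) nonfree_example"
    by (simp add: P rotate_tensor_def act_def vec_eq_iff sum_3 nonfree_example_def algebra_simps)
  then show ?thesis
    using inv unfolding orbit_def GL_def by blast
qed

lemma free_set_supp_iff:
  "free_set (supp T) \<longleftrightarrow>
     (\<forall>i j k i'. T $ i $ j $ k \<noteq> 0 \<longrightarrow> T $ i' $ j $ k \<noteq> 0 \<longrightarrow> i = i') \<and>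
     (\<forall>i j k j'. T $ i $ j $ k \<noteq> 0 \<longrightarrow> T $ i $ j' $ k \<noteq> 0 \<longrightarrow> j = j') \<and>
     (\<forall>i j k k'. T $ i $ j $ k \<noteq> 0 \<longrightarrow> T $ i $ j $ k' \<noteq> 0 \<longrightarrow> k = k')"
  unfolding free_set_def supp_def by fast

text \<open>These are the points to be excluded; \<open>free_points_empty\<close> shows that there
  are none.\<close>

definition free_points :: "tensor set" where
  "free_points = {P \<in> orbit nonfree_example. free_set (supp P)}"

lemma free_points_orbit: "P \<in> free_points \<Longrightarrow> P \<in> orbit nonfree_example"
  by (simp add: free_points_def)

lemma free_points_zero:
  assumes "P \<in> free_points" "P $ i $ j $ k \<noteq> 0"
  shows "i' \<noteq> i \<Longrightarrow> P $ i' $ j $ k = 0" "j' \<noteq> j \<Longrightarrow> P $ i $ j' $ k = 0" "k' \<noteq> k \<Longrightarrow> P $ i $ j $ k' = 0"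
  using assms unfolding free_points_def free_set_supp_iff by blast+

lemma relabel_free_points:
  assumes "P \<in> free_points" "bij p" "bij q" "bij r"
  shows "relabel p q r P \<in> free_points"
proof -
  have "inj p" "inj q" "inj r"
    using assms by (auto simp: bij_def)
  then have "free_set (supp (relabel p q r P))"
    using assms(1) unfolding free_points_def free_set_supp_iff relabel_def
    by (simp add: inj_eq) (metis injD)
  then show ?thesis
    using assms relabel_orbit by (simp add: free_points_def)
qed

lemma rotate_free_points:
  assumes "P \<in> free_points"
  shows "rotate_tensor P \<in> free_points"
proof -
  have "free_set (supp (rotate_tensor P))"
    using assms unfolding free_points_def free_set_supp_iff rotate_tensor_def
    by (simp only: mem_Collect_eq vec_lambda_beta) blast
  then show ?thesis
    using assms rotate_nonfree_orbit by (simp add: free_points_def)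
qed

section \<open>Number of nonzero entries in a slice\<close>

text \<open>A slice supported at one position has rank at most one, but it is equivalent to the
  contraction of \<open>nonfree_example\<close> with a nonzero vector \<open>v\<close>.\<close>

lemma slice_two_entries:
  assumes "P \<in> orbit nonfree_example"
  shows "\<exists>j k. (j, k) \<noteq> (j0, k0) \<and> P $ i $ j $ k \<noteq> 0"
proof (rule ccontr)
  assume single: "\<not> ?thesis"
  obtain g1 g2 g3 where P: "P = act (g1, g2, g3) nonfree_example"
    and inv: "invertible g1" "invertible g2" "invertible g3"
    using assms by (auto simp: orbit_def GL_def)
  have inv': "invertible (transpose g1)" "invertible (transpose g3)"
    using inv by (simp_all add: invertible_det_nz)
  define v where "v = transpose g1 *v axis i 1"
  define A where "A = contract P (axis i 1)"
  define M where "M = contract nonfree_example v"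
  obtain h2 where h2: "h2 ** g2 = mat 1"
    using inv(2) by (auto simp: invertible_def)
  obtain h3 where h3: "transpose g3 ** h3 = mat 1"
    using inv'(2) unfolding invertible_def by blast
  have "A = g2 ** M ** transpose g3"
    by (simp add: A_def M_def P contract_act v_def)
  then have "h2 ** A ** h3 = (h2 ** g2) ** M ** (transpose g3 ** h3)"
    by (simp add: matrix_mul_assoc)
  then have M: "M = h2 ** A ** h3"
    by (simp add: h2 h3)
  have "A $ j $ k = (if j = j0 \<and> k = k0 then P $ i $ j0 $ k0 else 0)" for j k
    using single by (auto simp: A_def contract_def axis_def if_distrib[of "\<lambda>x. x * _"] cong: if_cong)
  then have "M $ j $ k = h2 $ j $ j0 * P $ i $ j0 $ k0 * h3 $ k0 $ k" for j k
    using exhaust_3[of j0] exhaust_3[of k0] by (auto simp: M matrix_matrix_mult_def sum_3)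
  then have "M $ j $ k * M $ j' $ k' = M $ j $ k' * M $ j' $ k" for j k j' k'
    by simp
  \<comment> \<open>The principal minors of \<open>M\<close> are \<open>v\<^sub>1\<^sup>2\<close>,
    \<open>v\<^sub>3\<^sup>2 - v\<^sub>1\<^sup>2\<close> and
    \<open>v\<^sub>2\<^sup>2\<close>.\<close>
  from this[of 2 2 3 3] this[of 1 1 2 2] this[of 1 1 3 3] have "v = 0"
    by (simp add: M_def contract_def nonfree_example_def vec_eq_iff forall_3 sum_3)
  then have "axis i 1 = (0 :: complex^3)"
    using inv'(1)
    by (metis v_def invertible_def matrix_left_invertible_ker)
  then show False
    by (simp add: axis_eq_0_iff)
qed

lemma binary_cubic_coeffs_eq:
  fixes c0 :: complex
  assumes "\<And>x y. c0 * x^3 + c1 * x\<^sup>2 * y + c2 * x * y\<^sup>2 + c3 * y^3 =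
     d0 * x^3 + d1 * x\<^sup>2 * y + d2 * x * y\<^sup>2 + d3 * y^3"
  shows "c0 = d0 \<and> c1 = d1 \<and> c2 = d2 \<and> c3 = d3"
proof -
  have "c0 = d0" "c3 = d3"
    using assms[of 1 0] assms[of 0 1] by simp_all
  then have "c1 + c2 = d1 + d2" "c2 - c1 = d2 - d1"
    using assms[of 1 1] assms[of 1 "-1"] by (simp_all add: algebra_simps)
  then have "2 * c1 = 2 * d1" "2 * c2 = 2 * d2"
    by - algebra+
  then show ?thesis
    using \<open>c0 = d0\<close> \<open>c3 = d3\<close> by simp
qed

lemma binary_cubic_split:
  fixes a1 :: complex
  assumes "\<And>x y. (a1 * x + a2 * y)\<^sup>2 * (b1 * x + b2 * y) =
    c0 * x^3 + c1 * x\<^sup>2 * y + c2 * x * y\<^sup>2 + c3 * y^3"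
  shows "a1\<^sup>2 * b1 = c0" "2 * a1 * a2 * b1 + a1\<^sup>2 * b2 = c1"
    "2 * a1 * a2 * b2 + a2\<^sup>2 * b1 = c2" "a2\<^sup>2 * b2 = c3"
proof -
  have "(a1\<^sup>2 * b1) * x^3 + (2 * a1 * a2 * b1 + a1\<^sup>2 * b2) * x\<^sup>2 * y
      + (2 * a1 * a2 * b2 + a2\<^sup>2 * b1) * x * y\<^sup>2 + (a2\<^sup>2 * b2) * y^3 =
      c0 * x^3 + c1 * x\<^sup>2 * y + c2 * x * y\<^sup>2 + c3 * y^3" for x y
    unfolding assms[symmetric] by algebra
  from binary_cubic_coeffs_eq[OF this]
  show "a1\<^sup>2 * b1 = c0" "2 * a1 * a2 * b1 + a1\<^sup>2 * b2 = c1"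
    "2 * a1 * a2 * b2 + a2\<^sup>2 * b1 = c2" "a2\<^sup>2 * b2 = c3"
    by auto
qed

text \<open>Restricting the determinant to the plane of the first and the \<open>p\<close>-th basis
  vector shows that only \<open>a $ 1\<close> and \<open>b $ 1\<close> survive, so \<open>a\<close>
  and \<open>b\<close> are proportional.\<close>

lemma no_diagonal_slice:
  assumes "P \<in> free_points"
  shows "\<not> (P $ 1 $ 1 $ 1 \<noteq> 0 \<and> P $ 1 $ 2 $ 2 \<noteq> 0 \<and> P $ 1 $ 3 $ 3 \<noteq> 0)"
proof
  assume "P $ 1 $ 1 $ 1 \<noteq> 0 \<and> P $ 1 $ 2 $ 2 \<noteq> 0 \<and> P $ 1 $ 3 $ 3 \<noteq> 0"
  then have nz: "P $ 1 $ 1 $ 1 \<noteq> 0" "P $ 1 $ 2 $ 2 \<noteq> 0" "P $ 1 $ 3 $ 3 \<noteq> 0"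
    by auto
  note zero = free_points_zero[OF assms]
  have z1: "P $ 1 $ 1 $ 2 = 0" "P $ 1 $ 1 $ 3 = 0" "P $ 1 $ 2 $ 1 = 0" "P $ 1 $ 2 $ 3 = 0"
    "P $ 1 $ 3 $ 1 = 0" "P $ 1 $ 3 $ 2 = 0"
    by (simp_all add: zero(3)[OF nz(1)] zero(3)[OF nz(2)] zero(3)[OF nz(3)])
  obtain a b :: "complex^3" where
    ab: "\<forall>y. det (contract P y) = (\<Sum>i\<in>UNIV. a $ i * y $ i)\<^sup>2 * (\<Sum>i\<in>UNIV. b $ i * y $ i)"
    and indep: "\<forall>s t. s *s a + t *s b = 0 \<longrightarrow> s = 0 \<and> t = 0"
    using det_contract_orbit[OF free_points_orbit[OF assms]] by blast
  define \<alpha> where "\<alpha> = P $ 1 $ 1 $ 1 * P $ 1 $ 2 $ 2 * P $ 1 $ 3 $ 3"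
  have \<alpha>: "\<alpha> \<noteq> 0"
    using nz by (simp add: \<alpha>_def)
  have main: "a $ 1 ^ 2 * b $ 1 = \<alpha> \<and> a $ p = 0 \<and> b $ p = 0" if p: "p \<noteq> 1" for p
  proof -
    have z2: "P $ p $ 1 $ 1 = 0" "P $ p $ 2 $ 2 = 0" "P $ p $ 3 $ 3 = 0"
      using p by (simp_all add: zero(1)[OF nz(1)] zero(1)[OF nz(2)] zero(1)[OF nz(3)])
    define q where "q = (\<lambda>j k. P $ p $ j $ k)"
    define B where "B = P $ 1 $ 1 $ 1 * q 2 3 * q 3 2 + P $ 1 $ 2 $ 2 * q 1 3 * q 3 1
      + P $ 1 $ 3 $ 3 * q 1 2 * q 2 1"
    define C where "C = q 1 2 * q 2 3 * q 3 1 + q 1 3 * q 2 1 * q 3 2"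
    \<comment> \<open>Slice 1 is diagonal and freeness clears the diagonal of slice
      \<open>p\<close>, so there is no \<open>x\<^sup>2 * y\<close> term.\<close>
    have "(a $ 1 * x + a $ p * y)\<^sup>2 * (b $ 1 * x + b $ p * y) =
        \<alpha> * x^3 + 0 * x\<^sup>2 * y + (- B) * x * y\<^sup>2 + C * y^3" for x y
    proof -
      let ?y = "x *s axis 1 1 + y *s axis p 1"
      have s: "(\<Sum>i\<in>UNIV. c i * ?y $ i) = c 1 * x + c p * y" for c :: "3 \<Rightarrow> complex"
        using p exhaust_3[of p] by (auto simp: sum_3 axis_def)
      have "contract P ?y $ j $ k = P $ 1 $ j $ k * x + q j k * y" for j k
        using s[of "\<lambda>i. P $ i $ j $ k"] by (simp add: contract_def q_def mult.commute)
      then have "det (contract P ?y) = \<alpha> * x^3 + 0 * x\<^sup>2 * y + (- B) * x * y\<^sup>2 + C * y^3"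
        unfolding det_3 by (simp add: z1 z2 q_def B_def C_def \<alpha>_def power_numeral_reduce algebra_simps)
      then show ?thesis
        using ab[rule_format, of ?y] by (simp only: s)
    qed
    note c = binary_cubic_split[OF this]
    \<comment> \<open>A nonzero product in \<open>C\<close> fills a transversal of slice
      \<open>p\<close>. Freeness then clears the other off-diagonal entries, and each term of
      \<open>B\<close> contains one of them.\<close>
    have CB: "B = 0" if "C \<noteq> 0"
    proof -
      have "q 1 2 \<noteq> 0 \<and> q 2 3 \<noteq> 0 \<and> q 3 1 \<noteq> 0 \<or> q 1 3 \<noteq> 0 \<and> q 2 1 \<noteq> 0 \<and> q 3 2 \<noteq> 0"
        using that by (auto simp: C_def)
      then show ?thesis
      proof (elim disjE conjE)
        assume "q 1 2 \<noteq> 0" "q 2 3 \<noteq> 0" "q 3 1 \<noteq> 0"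
        then have "q 1 3 = 0" "q 2 1 = 0" "q 3 2 = 0"
          using zero(3)[of p 1 2 3] zero(3)[of p 2 3 1] zero(3)[of p 3 1 2] by (simp_all add: q_def)
        then show ?thesis
          by (simp add: B_def)
      next
        assume "q 1 3 \<noteq> 0" "q 2 1 \<noteq> 0" "q 3 2 \<noteq> 0"
        then have "q 1 2 = 0" "q 2 3 = 0" "q 3 1 = 0"
          using zero(3)[of p 1 3 2] zero(3)[of p 2 1 3] zero(3)[of p 3 2 1] by (simp_all add: q_def)
        then show ?thesis
          by (simp add: B_def)
      qed
    qed
    have a1: "a $ 1 \<noteq> 0" and b1: "b $ 1 \<noteq> 0"
      using c(1) \<alpha> by auto
    have e: "2 * a $ p * b $ 1 + a $ 1 * b $ p = 0"
      using c(2) a1 by algebra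
    have "a $ p = 0"
    proof (rule ccontr)
      assume ap: "a $ p \<noteq> 0"
      then have bp: "b $ p \<noteq> 0"
        using e b1 by auto
      then have "B = 0"
        using CB c(4) ap by auto
      then have "2 * a $ 1 * b $ p + a $ p * b $ 1 = 0"
        using c(3) ap by algebra
      \<comment> \<open>Twice \<open>e\<close> minus the preceding relation is
        \<open>3 * a $ p * b $ 1 = 0\<close>.\<close>
      then have "a $ p * b $ 1 = 0"
        using e by algebra
      then show False
        using ap b1 by simp
    qed
    then show ?thesis
      using e a1 c(1) by simp
  qed
  from main[of 2] main[of 3] have "b $ 1 *s a + (- a $ 1) *s b = 0"
    by (simp add: vec_eq_iff forall_3)
  then show False
    using indep[rule_format, of "b $ 1" "- a $ 1"] main[of 2] \<alpha> by auto
qed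

lemma bij_3:
  fixes i j k :: 3
  assumes "i \<noteq> j" "i \<noteq> k" "j \<noteq> k"
  shows "bij (\<lambda>x::3. if x = 1 then i else if x = 2 then j else k)"
proof -
  have "inj (\<lambda>x::3. if x = 1 then i else if x = 2 then j else k)"
    using assms by (auto simp: inj_def forall_3)
  then show ?thesis
    by (simp only: bij_def finite_UNIV_inj_surj[OF finite] simp_thms)
qed

lemma ex_bij_3:
  fixes i j k :: 3
  assumes "i \<noteq> j" "i \<noteq> k" "j \<noteq> k"
  obtains p :: "3 \<Rightarrow> 3" where "bij p" "p 1 = i" "p 2 = j" "p 3 = k"
  using bij_3[OF assms] that[of "\<lambda>x::3. if x = 1 then i else if x = 2 then j else k"] by simp

lemma ex_3: "(\<exists>i::3. P i) \<longleftrightarrow> P 1 \<or> P 2 \<or> P 3"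
  by (metis exhaust_3)

lemma ex_third_3:
  fixes i j :: 3
  obtains k where "k \<noteq> i" "k \<noteq> j"
proof -
  have "\<exists>k. k \<noteq> i \<and> k \<noteq> j"
    using exhaust_3[of i] exhaust_3[of j] by (elim disjE) (simp_all add: ex_3)
  then show thesis
    using that by blast
qed

text \<open>A relabelling brings slice \<open>i\<close> to the front and the positions
  \<open>(q m, r m)\<close> onto its diagonal.\<close>

lemma slice_not_three_entries:
  fixes q r :: "3 \<Rightarrow> 3"
  assumes "P \<in> free_points" "bij q" "bij r"
  shows "\<exists>m. P $ i $ q m $ r m = 0"
proof -
  obtain j k where jk: "i \<noteq> j" "i \<noteq> k" "j \<noteq> k"
    by (metis ex_third_3)
  obtain p :: "3 \<Rightarrow> 3" where p: "bij p" "p 1 = i" "p 2 = j" "p 3 = k"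
    by (rule ex_bij_3[OF jk])
  show ?thesis
    using no_diagonal_slice[OF relabel_free_points[OF assms(1) p(1) assms(2,3)]] p(2)
    unfolding relabel_def by auto
qed

lemma slice_not_three:
  assumes "P \<in> free_points" "j \<noteq> j'" "j \<noteq> j''" "j' \<noteq> j''" "k \<noteq> k'" "k \<noteq> k''" "k' \<noteq> k''"
    "P $ i $ j $ k \<noteq> 0" "P $ i $ j' $ k' \<noteq> 0"
  shows "P $ i $ j'' $ k'' = 0"
proof -
  obtain q :: "3 \<Rightarrow> 3" where q: "bij q" "q 1 = j" "q 2 = j'" "q 3 = j''"
    by (rule ex_bij_3[OF assms(2-4)])
  obtain r :: "3 \<Rightarrow> 3" where r: "bij r" "r 1 = k" "r 2 = k'" "r 3 = k''"
    by (rule ex_bij_3[OF assms(5-7)])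
  show ?thesis
    using slice_not_three_entries[OF assms(1) q(1) r(1), of i] assms(8,9)
    by (simp add: ex_3 q r)
qed

section \<open>Transversals spread over two slices\<close>

text \<open>The planes \<open>z = 0\<close> and \<open>x = 0\<close> force
  \<open>a2 = b1 = b3 = 0\<close>; then the monomial \<open>x * y * z\<close> occurs on the left
  with the nonzero coefficient \<open>2 * a1 * a3 * b2\<close>.\<close>

lemma cubic_not_square_times_linear:
  fixes a1 :: complex
  assumes "u \<noteq> 0" "v \<noteq> 0"
    and eq: "\<And>x y z. (a1 * x + a2 * y + a3 * z)\<^sup>2 * (b1 * x + b2 * y + b3 * z) = u * x\<^sup>2 * y + v * y * z\<^sup>2"
  shows False
proof -
  have "(a1 * x + a2 * y)\<^sup>2 * (b1 * x + b2 * y) = 0 * x^3 + u * x\<^sup>2 * y + 0 * x * y\<^sup>2 + 0 * y^3" for x y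
    using eq[of x y 0] by simp
  note c = binary_cubic_split[OF this]
  have "(a3 * x + a2 * y)\<^sup>2 * (b3 * x + b2 * y) = 0 * x^3 + v * x\<^sup>2 * y + 0 * x * y\<^sup>2 + 0 * y^3" for x y
    using eq[of 0 y x] by (simp add: algebra_simps)
  note d = binary_cubic_split[OF this]
  have "a1 \<noteq> 0" "a3 \<noteq> 0"
    using c(2) d(2) assms(1,2) by auto
  moreover from this have "b1 = 0" "b3 = 0"
    using c(1) d(1) by auto
  moreover from this have "b2 \<noteq> 0"
    using c(2) assms(1) by auto
  moreover from this have "a2 = 0"
    using c(4) by auto
  ultimately have "2 * a1 * a3 * b2 = 0"
    using eq[of 1 1 1] c(2) d(2) by simp algebra
  then show False
    using \<open>a1 \<noteq> 0\<close> \<open>a3 \<noteq> 0\<close> \<open>b2 \<noteq> 0\<close> by simp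
qed

text \<open>
  The three entries and the counts in all three directions determine the support of \<open>P\<close> up to
  swapping the first two rows and columns.
\<close>

lemma no_transversal_two_one:
  assumes F: "P \<in> free_points"
    and nz: "P $ 1 $ 1 $ 1 \<noteq> 0" "P $ 1 $ 2 $ 2 \<noteq> 0" "P $ 2 $ 3 $ 3 \<noteq> 0"
  shows False
proof -
  note zero = free_points_zero[OF F]
  have F2: "rotate_tensor P \<in> free_points" and F3: "rotate_tensor (rotate_tensor P) \<in> free_points"
    using F rotate_free_points by auto
  note orb = free_points_orbit[OF F]
  note two = slice_two_entries[OF orb]
  note three1 = slice_not_three[OF F]
  \<comment> \<open>The rotated tensors give the bound on slices for a fixed second or third
    index.\<close>
  have three2: "P $ i'' $ j $ k'' = 0"
    if "k \<noteq> k'" "k \<noteq> k''" "k' \<noteq> k''" "i \<noteq> i'" "i \<noteq> i''" "i' \<noteq> i''"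
      "P $ i $ j $ k \<noteq> 0" "P $ i' $ j $ k' \<noteq> 0" for i i' i'' j k k' k''
    using slice_not_three[OF F2 that(1-6), of j] that(7,8) by (simp add: rotate_tensor_def)
  have three3: "P $ i'' $ j'' $ k = 0"
    if "i \<noteq> i'" "i \<noteq> i''" "i' \<noteq> i''" "j \<noteq> j'" "j \<noteq> j''" "j' \<noteq> j''"
      "P $ i $ j $ k \<noteq> 0" "P $ i' $ j' $ k \<noteq> 0" for i i' i'' j j' j'' k
    using slice_not_three[OF F3 that(1-6), of k] that(7,8) by (simp add: rotate_tensor_def)
  have z: "P $ 1 $ 1 $ 2 = 0" "P $ 1 $ 1 $ 3 = 0" "P $ 1 $ 2 $ 1 = 0" "P $ 1 $ 2 $ 3 = 0"
    "P $ 1 $ 3 $ 1 = 0" "P $ 1 $ 3 $ 2 = 0" "P $ 1 $ 3 $ 3 = 0"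
    "P $ 2 $ 1 $ 1 = 0" "P $ 2 $ 2 $ 2 = 0" "P $ 3 $ 1 $ 1 = 0" "P $ 3 $ 2 $ 2 = 0" "P $ 3 $ 3 $ 3 = 0"
    "P $ 2 $ 1 $ 3 = 0" "P $ 2 $ 2 $ 3 = 0" "P $ 2 $ 3 $ 1 = 0" "P $ 2 $ 3 $ 2 = 0"
    by (simp_all add: zero(1)[OF nz(1)] zero(1)[OF nz(2)] zero(1)[OF nz(3)] zero(2)[OF nz(1)]
      zero(2)[OF nz(2)] zero(2)[OF nz(3)] zero(3)[OF nz(1)] zero(3)[OF nz(2)] zero(3)[OF nz(3)])
  obtain a b :: "complex^3" where
    ab: "\<forall>y. det (contract P y) = (\<Sum>i\<in>UNIV. a $ i * y $ i)\<^sup>2 * (\<Sum>i\<in>UNIV. b $ i * y $ i)"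
    using det_contract_orbit[OF orb] by blast
  have no: False if "v \<noteq> 0"
    and "\<And>x y z. det (contract P (vector [x, y, z])) =
      P $ 1 $ 1 $ 1 * P $ 1 $ 2 $ 2 * P $ 2 $ 3 $ 3 * x\<^sup>2 * y + v * y * z\<^sup>2" for v
  proof (rule cubic_not_square_times_linear)
    show "P $ 1 $ 1 $ 1 * P $ 1 $ 2 $ 2 * P $ 2 $ 3 $ 3 \<noteq> 0"
      using nz by simp
    show "(a $ 1 * x + a $ 2 * y + a $ 3 * z)\<^sup>2 * (b $ 1 * x + b $ 2 * y + b $ 3 * z) =
      P $ 1 $ 1 $ 1 * P $ 1 $ 2 $ 2 * P $ 2 $ 3 $ 3 * x\<^sup>2 * y + v * y * z\<^sup>2" for x y z
      using ab[rule_format, of "vector [x, y, z]"] that(2)[of x y z] by (simp add: sum_3)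
  qed (fact that(1))
  \<comment> \<open>Freeness leaves only these two places for a second entry of slice 2.\<close>
  have "P $ 2 $ 1 $ 2 \<noteq> 0 \<or> P $ 2 $ 2 $ 1 \<noteq> 0"
    using two[of 3 3 2] by (simp add: ex_3 z)
  then show False
  proof
    assume n: "P $ 2 $ 1 $ 2 \<noteq> 0"
    have "P $ 2 $ 2 $ 1 = 0"
      by (rule three1[OF _ _ _ _ _ _ nz(3) n]) simp_all
    moreover have "P $ 3 $ 1 $ 2 = 0"
      by (simp add: zero(1)[OF n])
    moreover have "P $ 3 $ 1 $ 3 = 0"
      by (rule three2[OF _ _ _ _ _ _ nz(1) n]) simp_all
    moreover have "P $ 3 $ 3 $ 2 = 0"
      by (rule three3[OF _ _ _ _ _ _ nz(2) n]) simp_all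
    ultimately have z': "P $ 2 $ 2 $ 1 = 0" "P $ 3 $ 1 $ 2 = 0" "P $ 3 $ 1 $ 3 = 0" "P $ 3 $ 3 $ 2 = 0"
      by simp_all
    \<comment> \<open>Three positions of slice 3 remain open and at least two are filled. Position
      \<open>(2, 1)\<close> shares a row or a column with each of the others, so it is the empty
      one.\<close>
    have "P $ 3 $ 2 $ 3 \<noteq> 0 \<or> P $ 3 $ 3 $ 1 \<noteq> 0" "P $ 3 $ 2 $ 1 \<noteq> 0 \<or> P $ 3 $ 3 $ 1 \<noteq> 0"
      "P $ 3 $ 2 $ 1 \<noteq> 0 \<or> P $ 3 $ 2 $ 3 \<noteq> 0"
      using two[of 2 1 3] two[of 2 3 3] two[of 3 1 3] by (simp_all add: ex_3 z z')
    moreover have "P $ 3 $ 2 $ 3 = 0 \<and> P $ 3 $ 3 $ 1 = 0" if "P $ 3 $ 2 $ 1 \<noteq> 0"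
      using zero(2,3)[OF that] by simp
    ultimately have n1: "P $ 3 $ 2 $ 3 \<noteq> 0" and n2: "P $ 3 $ 3 $ 1 \<noteq> 0" and "P $ 3 $ 2 $ 1 = 0"
      by auto
    note z'' = z z' this(3)
    \<comment> \<open>The term in \<open>y * z\<^sup>2\<close> is the transversal with one entry in
      slice 2 and two in slice 3.\<close>
    show False
      by (rule no[of "P $ 2 $ 1 $ 2 * P $ 3 $ 2 $ 3 * P $ 3 $ 3 $ 1"])
        (simp_all add: n n1 n2 z'' det_3 contract_def sum_3 power2_eq_square algebra_simps)
  next
    \<comment> \<open>Mirror image of the first case, with the first two rows and columns
      swapped.\<close>
    assume n: "P $ 2 $ 2 $ 1 \<noteq> 0"
    have "P $ 2 $ 1 $ 2 = 0"
      by (rule three1[OF _ _ _ _ _ _ nz(3) n]) simp_all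
    moreover have "P $ 3 $ 2 $ 1 = 0"
      by (simp add: zero(1)[OF n])
    moreover have "P $ 3 $ 2 $ 3 = 0"
      by (rule three2[OF _ _ _ _ _ _ nz(2) n]) simp_all
    moreover have "P $ 3 $ 3 $ 1 = 0"
      by (rule three3[OF _ _ _ _ _ _ nz(1) n]) simp_all
    ultimately have z': "P $ 2 $ 1 $ 2 = 0" "P $ 3 $ 2 $ 1 = 0" "P $ 3 $ 2 $ 3 = 0" "P $ 3 $ 3 $ 1 = 0"
      by simp_all
    have "P $ 3 $ 1 $ 3 \<noteq> 0 \<or> P $ 3 $ 3 $ 2 \<noteq> 0" "P $ 3 $ 1 $ 2 \<noteq> 0 \<or> P $ 3 $ 3 $ 2 \<noteq> 0"
      "P $ 3 $ 1 $ 2 \<noteq> 0 \<or> P $ 3 $ 1 $ 3 \<noteq> 0"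
      using two[of 1 2 3] two[of 1 3 3] two[of 3 2 3] by (simp_all add: ex_3 z z')
    moreover have "P $ 3 $ 1 $ 3 = 0 \<and> P $ 3 $ 3 $ 2 = 0" if "P $ 3 $ 1 $ 2 \<noteq> 0"
      using zero(2,3)[OF that] by simp
    ultimately have n1: "P $ 3 $ 1 $ 3 \<noteq> 0" and n2: "P $ 3 $ 3 $ 2 \<noteq> 0" and "P $ 3 $ 1 $ 2 = 0"
      by auto
    note z'' = z z' this(3)
    show False
      by (rule no[of "P $ 2 $ 2 $ 1 * P $ 3 $ 1 $ 3 * P $ 3 $ 3 $ 2"])
        (simp_all add: n n1 n2 z'' det_3 contract_def sum_3 power2_eq_square algebra_simps)
  qed
qed

section \<open>No point of the orbit has free support\<close>

text \<open>Some term of the Leibniz expansion is nonzero.\<close>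

lemma det_nonzero_transversal:
  fixes A :: "'a::idom^'n^'n"
  assumes "det A \<noteq> 0"
  obtains p where "bij p" "\<And>m. A $ m $ p m \<noteq> 0"
proof -
  obtain p where p: "p permutes UNIV" "of_int (sign p) * (\<Prod>m\<in>UNIV. A $ m $ p m) \<noteq> 0"
    using assms sum.not_neutral_contains_not_neutral unfolding det_def by blast
  then have "\<And>m. A $ m $ p m \<noteq> 0"
    by (auto simp: prod_zero_iff)
  then show thesis
    using that permutes_bij[OF p(1)] by blast
qed

lemma two_one_split_3:
  fixes U V :: "3 \<Rightarrow> bool"
  assumes "\<And>m. U m \<or> V m"
  obtains "\<forall>m. U m" | "\<forall>m. V m"
  | q :: "3 \<Rightarrow> 3" where "bij q" "U (q 1)" "U (q 2)" "V (q 3)"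
  | q :: "3 \<Rightarrow> 3" where "bij q" "V (q 1)" "V (q 2)" "U (q 3)"
proof -
  have "(\<forall>m. U m) \<or> (\<forall>m. V m) \<or> (\<exists>i j k. i \<noteq> j \<and> i \<noteq> k \<and> j \<noteq> k \<and>
     (U i \<and> U j \<and> V k \<or> V i \<and> V j \<and> U k))"
  proof -
    have d: "(1::3) \<noteq> 2" "(1::3) \<noteq> 3" "(2::3) \<noteq> 3"
      by simp_all
    show ?thesis
      unfolding forall_3 using assms[of 1] assms[of 2] assms[of 3] d by metis
  qed
  then consider "\<forall>m. U m" | "\<forall>m. V m"
    | i j k where "i \<noteq> j" "i \<noteq> k" "j \<noteq> k" "U i \<and> U j \<and> V k"
    | i j k where "i \<noteq> j" "i \<noteq> k" "j \<noteq> k" "V i \<and> V j \<and> U k"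
    by blast
  then show thesis
  proof cases
    case 3
    then show thesis
      using ex_bij_3[OF 3(1-3)] that(3) 3(4) by metis
  next
    case 4
    then show thesis
      using ex_bij_3[OF 4(1-3)] that(4) 4(4) by metis
  qed (use that in blast)+
qed

text \<open>If \<open>a $ i * b $ i\<close> were nonzero, the coefficient of
  \<open>y\<^sub>i\<^sup>3\<close> would yield a slice with three entries. So \<open>a\<close> and
  \<open>b\<close> have disjoint supports and some \<open>y\<^sub>i\<^sup>2 y\<^sub>j\<close> has a
  nonzero coefficient. The resulting transversal of the sum of slices \<open>i\<close> and
  \<open>j\<close> splits as 3+0 or 2+1, and both are excluded.\<close>

lemma free_points_empty: "P \<notin> free_points"
proof
  assume F: "P \<in> free_points"
  obtain a b :: "complex^3" where
    ab: "\<forall>y. det (contract P y) = (\<Sum>i\<in>UNIV. a $ i * y $ i)\<^sup>2 * (\<Sum>i\<in>UNIV. b $ i * y $ i)"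
    and indep: "\<forall>s t. s *s a + t *s b = 0 \<longrightarrow> s = 0 \<and> t = 0"
    using det_contract_orbit[OF free_points_orbit[OF F]] by blast
  have pick: "(\<Sum>i\<in>UNIV. c $ i * axis m 1 $ i) = c $ m" for c :: "complex^3" and m
    by (simp add: axis_def if_distrib[of "\<lambda>x. _ * x"] cong: if_cong)
  have cpick: "contract P (axis i 1) $ m $ k = P $ i $ m $ k" for i m k
    by (simp add: contract_def axis_def if_distrib[of "\<lambda>x. x * _"] cong: if_cong)
  have ab0: "a $ i * b $ i = 0" for i
  proof (rule ccontr)
    assume "a $ i * b $ i \<noteq> 0"
    then have "det (contract P (axis i 1)) \<noteq> 0"
      by (simp add: ab pick)
    then obtain p where "bij p" "\<And>m. P $ i $ m $ p m \<noteq> 0"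
      using det_nonzero_transversal cpick by metis
    then show False
      using slice_not_three_entries[OF F bij_id, of p i] by auto
  qed
  have "a \<noteq> 0" "b \<noteq> 0"
    using indep[rule_format, of 1 0] indep[rule_format, of 0 1] by auto
  then obtain i j where ai: "a $ i \<noteq> 0" and bj: "b $ j \<noteq> 0"
    by (auto simp: vec_eq_iff)
  have "b $ i = 0" "a $ j = 0"
    using ab0[of i] ab0[of j] ai bj by auto
  with bj have ij: "i \<noteq> j"
    by auto
  obtain k where k: "k \<noteq> i" "k \<noteq> j"
    by (rule ex_third_3)
  have "det (contract P (axis i 1 + axis j 1)) = (a $ i)\<^sup>2 * b $ j"
    by (simp add: ab distrib_left sum.distrib pick \<open>b $ i = 0\<close> \<open>a $ j = 0\<close>)
  then have "det (contract P (axis i 1 + axis j 1)) \<noteq> 0"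
    using ai bj by simp
  moreover have "contract P (axis i 1 + axis j 1) $ m $ k = P $ i $ m $ k + P $ j $ m $ k" for m k
    using cpick by (simp add: contract_def distrib_right sum.distrib)
  ultimately obtain r where r: "bij r" "\<And>m. P $ i $ m $ r m + P $ j $ m $ r m \<noteq> 0"
    using det_nonzero_transversal by metis
  then have "P $ i $ m $ r m \<noteq> 0 \<or> P $ j $ m $ r m \<noteq> 0" for m
    by (metis add_0)
  then show False
  proof (cases rule: two_one_split_3[where U = "\<lambda>m. P $ i $ m $ r m \<noteq> 0"
        and V = "\<lambda>m. P $ j $ m $ r m \<noteq> 0", consumes 1])
    case 1
    then show False
      using slice_not_three_entries[OF F bij_id r(1), of i] by auto
  next
    case 2
    then show False
      using slice_not_three_entries[OF F bij_id r(1), of j] by auto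
  next
    \<comment> \<open>The slice with two entries becomes slice 1 and the other slice 2;
      \<open>q\<close> on rows and \<open>r \<circ> q\<close> on columns put the transversal on the
      diagonal.\<close>
    case (3 q)
    obtain p :: "3 \<Rightarrow> 3" where p: "bij p" "p 1 = i" "p 2 = j" "p 3 = k"
      using ex_bij_3[of i j k] ij k by metis
    show False
      using no_transversal_two_one[OF relabel_free_points[OF F p(1) 3(1) bij_comp[OF 3(1) r(1)]]] 3 p
      by (simp add: relabel_def)
  next
    case (4 q)
    obtain p :: "3 \<Rightarrow> 3" where p: "bij p" "p 1 = j" "p 2 = i" "p 3 = k"
      using ex_bij_3[of j i k] ij k by metis
    show False
      using no_transversal_two_one[OF relabel_free_points[OF F p(1) 4(1) bij_comp[OF 4(1) r(1)]]] 4 p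
      by (simp add: relabel_def)
  qed
qed

theorem theorem1p3:
  shows "\<exists>T :: tensor. concise T \<and> free_tensor T \<and>
    (\<exists>S \<in> closure (orbit T). concise S \<and> \<not> free_tensor S)"
proof -
  have "\<not> free_tensor nonfree_example"
    using free_points_empty unfolding free_tensor_def free_points_def orbit_def by blast
  then show ?thesis
    using concise_free_example free_tensor_free_example nonfree_example_in_closure
      concise_nonfree_example by blast
qed

end
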